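(* Let $H^\infty$ be an infinite hallway. If $\ell_{\alpha\beta}^\epsilon$ and $\ell_{\gamma\delta}^\epsilon$ (with $\alpha,\beta,\gamma,\delta\in\mathbb{R}$) are both lines of sight for $H^\infty$, then $\alpha=\gamma$. In other words, all lines of sight for $H^\infty$ have the same slope.
   Context: Let $\mathbb{R}^\epsilon=\{a+b\epsilon:a,b\in\mathbb{R}\}$ be the two-dimensional real vector space with basis $\{1,\epsilon\}$, totally ordered by $a+b\epsilon<c+d\epsilon$ iff $a<c$, or $a=c$ and $b<d$; intervals in $\mathbb{R}^\epsilon$ are taken with respect to this order. An infinite hallway is a set $H^\infty=\bigcup_{i\ge 0}\{i\}\times(\mathbb{R}^\epsilon\setminus D_i)\subset\mathbb{R}\times\mathbb{R}^\epsilon$, where $D_i=(d_i,d_i+1)\subset\mathbb{R}^\epsilon$ with $d_i\in\mathbb{Z}$ for all integers $i\ge 0$ (the $i$th doorway). For $\alpha,\beta\in\mathbb{R}$ the infinite line of slope $\alpha$ is $\ell^\epsilon_{\alpha\beta}=\{(x,\alpha x+\beta+t\epsilon):x,t\in\mathbb{R}\}$. For $(x,y)\in\mathbb{R}\times\mathbb{R}^\epsilon$ let $\mathrm{proj}_\alpha(x,y)=y-\alpha x$. Define $\ell^\epsilon_{\alpha\beta}\vee H^\infty=\{a\in\mathbb{R}: a+b\epsilon\in \mathrm{proj}_\alpha(\ell^\epsilon_{\alpha\beta})\cap(\mathbb{R}^\epsilon\setminus\mathrm{proj}_\alpha(H^\infty))\text{ for some }b\in\mathbb{R}\}$. The infinite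 line $\ell^\epsilon_{\alpha\beta}$ is a line of sight for $H^\infty$ if $\ell^\epsilon_{\alpha\beta}\vee H^\infty\ne\emptyset$. *)

theory Defs
  imports "HOL-Analysis.Product_Vector" "HOL-Library.Product_Lexorder"
begin

text \<open>
  The ordered vector space \<open>\<real>\<^sup>\<epsilon>\<close>: \<open>a + b\<epsilon>\<close> is the pair \<open>(a, b)\<close>. The vector space structure is
  the one of \<^theory>\<open>HOL-Analysis.Product_Vector\<close>, and the order on pairs is the lexicographic one
  of \<^theory>\<open>HOL-Library.Product_Lexorder\<close>. The latter is incompatible with the componentwise
  order of \<open>HOL-Library.Product_Order\<close>, which \<open>HOL-Analysis.Analysis\<close> loads.
\<close>

type_synonym real_eps = "real \<times> real"

definition eps :: real_eps where
  "eps = (0, 1)"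

definition emb :: "real \<Rightarrow> real_eps" where
  "emb a = (a, 0)"

lemma emb_plus_eps: "emb a + b *\<^sub>R eps = (a, b)"
  by (simp add: emb_def eps_def)

lemma less_real_eps_iff:
  "emb a + b *\<^sub>R eps < emb c + d *\<^sub>R eps \<longleftrightarrow> a < c \<or> a = c \<and> b < d"
  by (auto simp: emb_plus_eps)

text \<open>The interval is taken in \<open>\<real>\<^sup>\<epsilon>\<close>, so it contains \<open>k + b\<epsilon>\<close> for \<open>b > 0\<close> and \<open>k + 1 + b\<epsilon>\<close>
  for \<open>b < 0\<close>.\<close>

definition doorway :: "int \<Rightarrow> real_eps set" where
  "doorway k = {emb (of_int k) <..< emb (of_int k + 1)}"

definition infinite_hallway :: "(real \<times> real_eps) set \<Rightarrow> bool" where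
  "infinite_hallway H \<longleftrightarrow>
    (\<exists>d :: nat \<Rightarrow> int. H = (\<Union>i. {real i} \<times> (UNIV - doorway (d i))))"

definition infinite_line :: "real \<Rightarrow> real \<Rightarrow> (real \<times> real_eps) set" where
  "infinite_line \<alpha> \<beta> = {(x, emb (\<alpha> * x + \<beta>) + t *\<^sub>R eps) | x t. True}"

definition proj_slope :: "real \<Rightarrow> real \<times> real_eps \<Rightarrow> real_eps" where
  "proj_slope \<alpha> = (\<lambda>(x, y). y - emb (\<alpha> * x))"

definition sight_set :: "real \<Rightarrow> real \<Rightarrow> (real \<times> real_eps) set \<Rightarrow> real set" where
  "sight_set \<alpha> \<beta> H =
    {a. \<exists>b. emb a + b *\<^sub>R eps \<in> proj_slope \<alpha> ` infinite_line \<alpha> \<beta> \<inter> (UNIV - proj_slope \<alpha> ` H)}"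

text \<open>The line is passed as its slope and intercept, which are determined by its points.\<close>

definition line_of_sight :: "real \<Rightarrow> real \<Rightarrow> (real \<times> real_eps) set \<Rightarrow> bool" where
  "line_of_sight \<alpha> \<beta> H \<longleftrightarrow> sight_set \<alpha> \<beta> H \<noteq> {}"

end

theory Submission
  imports Defs
begin

text \<open>
  If \<open>(\<beta>, b)\<close> is missed by the projection of the hallway, then for every \<open>i\<close> the point of height
  \<open>\<alpha> i + \<beta> + b\<epsilon>\<close> above \<open>i\<close> must lie in the doorway \<open>(d\<^sub>i, d\<^sub>i + 1)\<close>. Forgetting the infinitesimal
  part, the real line \<open>\<alpha> x + \<beta>\<close> passes through the closed unit interval \<open>[d\<^sub>i, d\<^sub>i + 1]\<close> at every
  \<open>x = i\<close>. Two lines of sight are therefore at vertical distance at most \<open>1\<close> at all natural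
  numbers, whereas by the Archimedean property lines of different slopes drift arbitrarily far
  apart.
\<close>

text \<open>The infinitesimal part can decide membership only at the two end points of a doorway, so its
  effect on the real part is no more than to close the interval.\<close>

lemma doorway_real_part:
  assumes "(y, b) \<in> doorway k"
  shows "y \<in> {of_int k..of_int k + 1}"
  using assms by (auto simp: doorway_def emb_def)

text \<open>The projection collapses the line to the fibre over its intercept, so the witness of the
  sight set is \<open>\<beta> + b\<epsilon>\<close>; its preimage above \<open>i\<close> is not in the hallway, hence in the doorway.\<close>

lemma line_of_sight_within_doorways:
  assumes "line_of_sight \<alpha> \<beta> (\<Union>i. {real i} \<times> (UNIV - doorway (d i)))" (is "line_of_sight _ _ ?H")
  shows "\<alpha> * real i + \<beta> \<in> {of_int (d i)..of_int (d i) + 1}"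
proof -
  from assms obtain b where b: "(\<beta>, b) \<notin> proj_slope \<alpha> ` ?H"
    unfolding line_of_sight_def sight_set_def infinite_line_def
    by (auto simp: proj_slope_def emb_def eps_def)
  have fibre: "(\<beta>, b) = proj_slope \<alpha> (real i, (\<alpha> * real i + \<beta>, b))"
    by (simp add: proj_slope_def emb_def)
  have "(real i, (\<alpha> * real i + \<beta>, b)) \<notin> ?H"
    using b image_eqI[where f = "proj_slope \<alpha>", OF fibre] by (rule contrapos_nn)
  then have "(\<alpha> * real i + \<beta>, b) \<in> doorway (d i)"
    by blast
  then show ?thesis
    by (rule doorway_real_part)
qed

lemma slopes_eq_of_bounded_distance:
  fixes \<alpha> \<beta> \<gamma> \<delta> C :: real
  assumes bounded: "\<And>i. \<bar>(\<alpha> * real i + \<beta>) - (\<gamma> * real i + \<delta>)\<bar> \<le> C"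
  shows "\<alpha> = \<gamma>"
proof (rule ccontr)
  assume "\<alpha> \<noteq> \<gamma>"
  then obtain n where n: "C + \<bar>\<beta> - \<delta>\<bar> < real n * \<bar>\<alpha> - \<gamma>\<bar>"
    using reals_Archimedean3[of "\<bar>\<alpha> - \<gamma>\<bar>"] by auto
  have "real n * \<bar>\<alpha> - \<gamma>\<bar> = \<bar>(\<alpha> - \<gamma>) * real n\<bar>"
    by (simp add: abs_mult)
  also have "\<dots> = \<bar>((\<alpha> * real n + \<beta>) - (\<gamma> * real n + \<delta>)) - (\<beta> - \<delta>)\<bar>"
    by (simp add: left_diff_distrib)
  also have "\<dots> \<le> C + \<bar>\<beta> - \<delta>\<bar>"
    using bounded[of n] by linarith
  finally show False
    using n by linarith
qed

theorem theorem27: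
  fixes H :: "(real \<times> real_eps) set" and \<alpha> \<beta> \<gamma> \<delta> :: real
  assumes "infinite_hallway H"
    and "line_of_sight \<alpha> \<beta> H"
    and "line_of_sight \<gamma> \<delta> H"
  shows "\<alpha> = \<gamma>"
proof -
  from assms(1) obtain d where H: "H = (\<Union>i. {real i} \<times> (UNIV - doorway (d i)))"
    unfolding infinite_hallway_def by blast
  have "\<bar>(\<alpha> * real i + \<beta>) - (\<gamma> * real i + \<delta>)\<bar> \<le> 1" for i
    using line_of_sight_within_doorways[OF assms(2)[unfolded H], of i]
      line_of_sight_within_doorways[OF assms(3)[unfolded H], of i]
    by (auto simp: abs_le_iff)
  then show ?thesis
    by (rule slopes_eq_of_bounded_distance)
qed

end
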